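(* Let $m,n$ be integers with $n\ge3$ and $p:=m-n\ge1$. Let $G$ be the graph whose vertices are the maps $f:[n]\to[m]$ that are either constant or injective, with $f\sim f'$ iff $f(i)\ne f'(j)$ for all $i\ne j$ in $[n]$. Then $H_p(\mathcal N(G);\mathbb Z_2)\neq 0$.
   Context: $[k]=\{1,\dots,k\}$. The graph $G$ is the induced subgraph of the exponential graph $K_m^{K_n}$ on the constant and injective maps (injective maps carry loops). The neighbourhood complex $\mathcal N(G)$ is the simplicial complex whose simplices are the nonempty sets of vertices of $G$ having a common neighbour in $G$; $H_p(\cdot;\mathbb Z_2)$ denotes simplicial (equivalently singular) homology with $\mathbb Z_2$ coefficients. *)

theory Defs
  imports "HOL-Library.Z2" "HOL-Library.Poly_Mapping" "HOL-Library.FuncSet"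
    "HOL-Algebra.Elementary_Groups"
begin

section \<open>Simplicial homology with coefficients in \<open>\<int>\<^sub>2\<close>\<close>

text \<open>An abstract simplicial complex is given by its set of (nonempty, finite) simplices.\<close>

definition simplicial_complex :: "'a set set \<Rightarrow> bool" where
  "simplicial_complex K \<longleftrightarrow>
     (\<forall>\<sigma>\<in>K. finite \<sigma> \<and> \<sigma> \<noteq> {}) \<and> (\<forall>\<sigma>\<in>K. \<forall>\<tau>. \<tau> \<subseteq> \<sigma> \<longrightarrow> \<tau> \<noteq> {} \<longrightarrow> \<tau> \<in> K)"

definition chains_Z2 :: "nat \<Rightarrow> 'a set set \<Rightarrow> ('a set \<Rightarrow>\<^sub>0 bit) set" where
  "chains_Z2 p K = {c. Poly_Mapping.keys c \<subseteq> {\<sigma> \<in> K. card \<sigma> = p + 1}}"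

text \<open>The linear extension of \<open>\<sigma> \<mapsto> \<Sum>\<^sub>v\<^sub>\<in>\<^sub>\<sigma> (\<sigma> - {v})\<close>; no signs are needed in characteristic 2.
  The boundary of a 0-chain is 0, so the homology is unreduced.\<close>

definition boundary_Z2 :: "nat \<Rightarrow> ('a set \<Rightarrow>\<^sub>0 bit) \<Rightarrow> ('a set \<Rightarrow>\<^sub>0 bit)" where
  "boundary_Z2 p c =
     (if p = 0 then 0
      else (\<Sum>\<sigma> \<in> Poly_Mapping.keys c. \<Sum>v\<in>\<sigma>.
              Poly_Mapping.single (\<sigma> - {v}) (Poly_Mapping.lookup c \<sigma>)))"

definition cycle_group_Z2 :: "nat \<Rightarrow> 'a set set \<Rightarrow> ('a set \<Rightarrow>\<^sub>0 bit) monoid" where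
  "cycle_group_Z2 p K =
     \<lparr>carrier = {c \<in> chains_Z2 p K. boundary_Z2 p c = 0}, monoid.mult = (+), one = 0\<rparr>"

definition boundaries_Z2 :: "nat \<Rightarrow> 'a set set \<Rightarrow> ('a set \<Rightarrow>\<^sub>0 bit) set" where
  "boundaries_Z2 p K = boundary_Z2 (p + 1) ` chains_Z2 (p + 1) K"

definition homology_group_Z2 :: "nat \<Rightarrow> 'a set set \<Rightarrow> ('a set \<Rightarrow>\<^sub>0 bit) set monoid" where
  "homology_group_Z2 p K = cycle_group_Z2 p K Mod boundaries_Z2 p K"

lemma boundary_Z2_superset:
  assumes "finite S" "Poly_Mapping.keys c \<subseteq> S" "p \<noteq> 0"
  shows "boundary_Z2 p c =
    (\<Sum>\<sigma>\<in>S. \<Sum>v\<in>\<sigma>. Poly_Mapping.single (\<sigma> - {v}) (Poly_Mapping.lookup c \<sigma>))"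
proof -
  have "(\<Sum>\<sigma>\<in>Poly_Mapping.keys c. \<Sum>v\<in>\<sigma>. Poly_Mapping.single (\<sigma> - {v}) (Poly_Mapping.lookup c \<sigma>)) =
    (\<Sum>\<sigma>\<in>S. \<Sum>v\<in>\<sigma>. Poly_Mapping.single (\<sigma> - {v}) (Poly_Mapping.lookup c \<sigma>))"
    by (rule sum.mono_neutral_left[OF assms(1,2)]) (simp add: in_keys_iff)
  then show ?thesis unfolding boundary_Z2_def using assms(3) by simp
qed

lemma boundary_Z2_add: "boundary_Z2 p (c + d) = boundary_Z2 p c + boundary_Z2 p d"
proof (cases "p = 0")
  case False
  let ?S = "Poly_Mapping.keys c \<union> Poly_Mapping.keys d"
  have fin: "finite ?S" by simp
  show ?thesis
    unfolding boundary_Z2_superset[OF fin Poly_Mapping.keys_add False]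
      boundary_Z2_superset[OF fin Un_upper1 False] boundary_Z2_superset[OF fin Un_upper2 False]
      lookup_add single_add sum.distrib ..
qed (simp add: boundary_Z2_def)

lemma boundary_Z2_zero [simp]: "boundary_Z2 p 0 = 0"
  by (simp add: boundary_Z2_def)

lemma boundary_Z2_sum: "boundary_Z2 p (sum f A) = (\<Sum>x\<in>A. boundary_Z2 p (f x))"
  by (induction A rule: infinite_finite_induct) (auto simp: boundary_Z2_add)

lemma poly_mapping_Z2_add_self: "c + c = 0" for c :: "'b \<Rightarrow>\<^sub>0 bit"
  by (rule poly_mapping_eqI) (simp add: lookup_add)

lemma boundary_Z2_single:
  "p \<noteq> 0 \<Longrightarrow> boundary_Z2 p (Poly_Mapping.single \<sigma> a) = (\<Sum>v\<in>\<sigma>. Poly_Mapping.single (\<sigma> - {v}) a)"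
  by (subst boundary_Z2_superset[where S = "{\<sigma>}"]) auto

lemma sum_sym_Z2:
  fixes g :: "'a \<Rightarrow> 'a \<Rightarrow> ('b \<Rightarrow>\<^sub>0 bit)"
  assumes "finite A" "\<And>x y. g x y = g y x"
  shows "(\<Sum>x\<in>A. \<Sum>y\<in>A - {x}. g x y) = 0"
  using assms(1)
proof (induction A rule: finite_induct)
  case (insert a A)
  have "(\<Sum>y\<in>insert a A - {x}. g x y) = g x a + (\<Sum>y\<in>A - {x}. g x y)" if "x \<in> A" for x
  proof -
    have "insert a A - {x} = insert a (A - {x})" using that insert by auto
    then show ?thesis using insert by simp
  qed
  then have "(\<Sum>x\<in>A. \<Sum>y\<in>insert a A - {x}. g x y) = (\<Sum>x\<in>A. g x a)"
    using insert by (simp add: sum.distrib)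
  moreover have "insert a A - {a} = A" using insert by auto
  ultimately show ?case
    using insert by (simp add: assms(2)[of a] poly_mapping_Z2_add_self)
qed simp

lemma boundary_Z2_boundary_Z2:
  assumes "c \<in> chains_Z2 (p + 1) K"
  shows "boundary_Z2 p (boundary_Z2 (p + 1) c) = 0"
proof (cases "p = 0")
  case False
  have "(\<Sum>v\<in>\<sigma>. boundary_Z2 p (Poly_Mapping.single (\<sigma> - {v}) (Poly_Mapping.lookup c \<sigma>))) = 0"
    if "\<sigma> \<in> Poly_Mapping.keys c" for \<sigma>
  proof -
    have "card \<sigma> = p + 2" using that assms by (auto simp: chains_Z2_def)
    then have "finite \<sigma>" by (metis add_2_eq_Suc' card.infinite nat.distinct(1))
    then show ?thesis
      using False by (simp add: boundary_Z2_single)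
        (rule sum_sym_Z2, simp, metis Diff_insert Diff_insert2)
  qed
  then show ?thesis
    by (subst (2) boundary_Z2_def) (simp add: boundary_Z2_sum)
qed (simp add: boundary_Z2_def)

lemma chains_Z2_add: "c \<in> chains_Z2 p K \<Longrightarrow> d \<in> chains_Z2 p K \<Longrightarrow> c + d \<in> chains_Z2 p K"
  unfolding chains_Z2_def using Poly_Mapping.keys_add[of c d] by blast

lemma chains_Z2_zero: "0 \<in> chains_Z2 p K"
  by (simp add: chains_Z2_def)

lemma chains_Z2_sum:
  "(\<And>x. x \<in> A \<Longrightarrow> f x \<in> chains_Z2 p K) \<Longrightarrow> sum f A \<in> chains_Z2 p K"
  by (induction A rule: infinite_finite_induct) (auto intro: chains_Z2_add chains_Z2_zero)

lemma boundary_Z2_chain: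
  assumes "simplicial_complex K" "c \<in> chains_Z2 (p + 1) K"
  shows "boundary_Z2 (p + 1) c \<in> chains_Z2 p K"
proof -
  have "Poly_Mapping.single (\<sigma> - {v}) a \<in> chains_Z2 p K"
    if "\<sigma> \<in> Poly_Mapping.keys c" "v \<in> \<sigma>" for \<sigma> v and a :: bit
  proof -
    have \<sigma>: "\<sigma> \<in> K" "card \<sigma> = p + 2" using that assms by (auto simp: chains_Z2_def)
    then have c: "card (\<sigma> - {v}) = p + 1" using that by (simp add: card_Diff_singleton)
    then have "\<sigma> - {v} \<noteq> {}" by (metis Suc_eq_plus1 card.empty nat.distinct(1))
    then have "\<sigma> - {v} \<in> K"
      using \<sigma>(1) assms(1) unfolding simplicial_complex_def by (meson Diff_subset)
    then show ?thesis using c by (auto simp: chains_Z2_def)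
  qed
  then show ?thesis
    unfolding boundary_Z2_def by (auto intro!: chains_Z2_sum)
qed

lemma comm_group_cycle_group_Z2: "comm_group (cycle_group_Z2 p K)"
proof (rule comm_groupI)
  show "\<exists>y\<in>carrier (cycle_group_Z2 p K). y \<otimes>\<^bsub>cycle_group_Z2 p K\<^esub> x = \<one>\<^bsub>cycle_group_Z2 p K\<^esub>"
    if "x \<in> carrier (cycle_group_Z2 p K)" for x
    using that by (intro bexI[of _ x]) (simp_all add: cycle_group_Z2_def poly_mapping_Z2_add_self)
qed (simp_all add: cycle_group_Z2_def chains_Z2_add chains_Z2_zero boundary_Z2_add add_ac)

lemma subgroup_boundaries_Z2:
  assumes "simplicial_complex K"
  shows "subgroup (boundaries_Z2 p K) (cycle_group_Z2 p K)"
proof -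
  interpret comm_group "cycle_group_Z2 p K" by (rule comm_group_cycle_group_Z2)
  have sub: "boundaries_Z2 p K \<subseteq> carrier (cycle_group_Z2 p K)"
    using boundary_Z2_chain[OF assms] boundary_Z2_boundary_Z2
    by (fastforce simp: boundaries_Z2_def cycle_group_Z2_def)
  have inv: "inv\<^bsub>cycle_group_Z2 p K\<^esub> c = c" if "c \<in> carrier (cycle_group_Z2 p K)" for c
    using that by (intro inv_equality) (auto simp: cycle_group_Z2_def poly_mapping_Z2_add_self)
  show ?thesis
  proof (rule subgroupI)
    show "boundaries_Z2 p K \<noteq> {}"
      using chains_Z2_zero by (auto simp: boundaries_Z2_def)
    show "a \<otimes>\<^bsub>cycle_group_Z2 p K\<^esub> b \<in> boundaries_Z2 p K"
      if "a \<in> boundaries_Z2 p K" "b \<in> boundaries_Z2 p K" for a b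
      using that by (auto simp: boundaries_Z2_def cycle_group_Z2_def
          simp flip: boundary_Z2_add intro!: imageI chains_Z2_add)
  qed (use sub inv in auto)
qed

lemma comm_group_homology_group_Z2:
  assumes "simplicial_complex K"
  shows "comm_group (homology_group_Z2 p K)"
  unfolding homology_group_Z2_def
  by (intro comm_group.abelian_FactGroup comm_group_cycle_group_Z2 subgroup_boundaries_Z2 assms)

section \<open>Neighbourhood complexes\<close>

text \<open>A graph, possibly with loops, is given by its vertex set \<open>V\<close> and its adjacency relation
  \<open>adj\<close>. Restricting to finite simplices only matters when \<open>V\<close> is infinite.\<close>

definition neighbourhood_complex :: "'a set \<Rightarrow> ('a \<Rightarrow> 'a \<Rightarrow> bool) \<Rightarrow> 'a set set" where
  "neighbourhood_complex V adj =
     {A. A \<noteq> {} \<and> finite A \<and> A \<subseteq> V \<and> (\<exists>w\<in>V. \<forall>a\<in>A. adj a w)}"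

lemma simplicial_complex_neighbourhood_complex:
  "simplicial_complex (neighbourhood_complex V adj)"
  unfolding simplicial_complex_def neighbourhood_complex_def
  by (blast intro: finite_subset)

section \<open>The graph of constant and injective maps\<close>

text \<open>Maps \<open>{1..n} \<rightarrow> {1..m}\<close> are extensional functions (undefined outside \<open>{1..n}\<close>), so that
  distinct vertices are distinct as maps.\<close>

definition const_inj_maps :: "nat \<Rightarrow> nat \<Rightarrow> (nat \<Rightarrow> nat) set" where
  "const_inj_maps n m =
     {f \<in> {1..n} \<rightarrow>\<^sub>E {1..m}. (\<exists>c. \<forall>i\<in>{1..n}. f i = c) \<or> inj_on f {1..n}}"

definition exp_adj :: "nat \<Rightarrow> (nat \<Rightarrow> nat) \<Rightarrow> (nat \<Rightarrow> nat) \<Rightarrow> bool" where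
  "exp_adj n f f' \<longleftrightarrow> (\<forall>i\<in>{1..n}. \<forall>j\<in>{1..n}. i \<noteq> j \<longrightarrow> f i \<noteq> f' j)"

lemma exp_adj_sym: "exp_adj n f f' \<Longrightarrow> exp_adj n f' f"
  unfolding exp_adj_def by metis

end

theory Submission
  imports Defs
begin

text \<open>
  Label the cells of the grid with rows \<open>v\<^sub>0, \<dots>, v\<^sub>p\<close> (the vertices of a \<open>p\<close>-simplex, in a
  fixed order of all vertices) and columns \<open>1, \<dots>, n\<close> by \<open>v\<^sub>l(j)\<close>, and let \<open>\<phi>\<close> count modulo 2 the
  monotone lattice paths between opposite corners whose \<open>p + n = m\<close> labels are distinct and exhaust
  \<open>[m]\<close>. This is an Alexander--Whitney diagonal followed by multiplication in an exterior algebra.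

  \<open>\<phi>\<close> is a cocycle: given \<open>p + 2\<close> vertices, deleting a row, or a column, from the grid amounts to
  deleting a cell from a path, the deletions of corners of paths cancelling in pairs. A path of
  \<open>m + 1\<close> cells has a repeated label, so its cell deletions contribute an even number; and
  if \<open>w\<close> is a common neighbour, the label \<open>w(j)\<close> does not occur outside column \<open>j\<close>, so deleting
  a column contributes nothing.

  Finally, let \<open>g\<close> be the inclusion of \<open>[n]\<close> and \<open>C\<close> the set of the constants \<open>n + 1, \<dots>, m\<close>. All
  facets of the non-simplex \<open>{g, 1} \<union> C\<close> are simplices, and \<open>\<phi>\<close> is 1 only on \<open>{g} \<union> C\<close>: the
  others miss a label, or consist of constants, for which every path repeats a label.
\<close>

section \<open>Sums over lattice paths\<close>

text \<open>A list, not a set: equal results from different positions must be counted separately in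
  order to cancel modulo 2.\<close>

fun deletions :: "'a list \<Rightarrow> 'a list list" where
  "deletions [] = []"
| "deletions (x # xs) = xs # map ((#) x) (deletions xs)"

lemma deletions_append:
  "deletions (xs @ ys) = map (\<lambda>z. z @ ys) (deletions xs) @ map ((@) xs) (deletions ys)"
  by (induction xs) auto

lemma length_deletions: "z \<in> set (deletions xs) \<Longrightarrow> Suc (length z) = length xs"
  by (induction xs arbitrary: z) auto

lemma sum_list_map_eq_0:
  fixes F :: "'a \<Rightarrow> 'b :: monoid_add"
  shows "(\<And>x. x \<in> set xs \<Longrightarrow> F x = 0) \<Longrightarrow> sum_list (map F xs) = 0"
  by (induction xs) auto

lemma deletions_distinct:
  "distinct xs \<Longrightarrow> z \<in> set (deletions xs) \<Longrightarrow> \<exists>y\<in>set xs. set z = set xs - {y}"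
proof (induction xs arbitrary: z)
  case (Cons x xs)
  show ?case
  proof (cases "z = xs")
    case False
    then obtain z' where z': "z = x # z'" "z' \<in> set (deletions xs)" using Cons.prems by auto
    then obtain y where "y \<in> set xs" "set z' = set xs - {y}" using Cons by auto
    then show ?thesis using z' Cons.prems by (intro bexI[of _ y]) auto
  qed (use Cons.prems in auto)
qed simp

lemma sum_list_deletions_distinct:
  "distinct xs \<Longrightarrow>
    sum_list (map F (deletions xs)) = (\<Sum>v\<in>set xs. F (filter (\<lambda>x. x \<noteq> v) xs))"
proof (induction xs arbitrary: F)
  case (Cons x xs)
  have "filter (\<lambda>y. y \<noteq> x) xs = xs" using Cons.prems by (auto simp: filter_id_conv)
  moreover have "(\<Sum>v\<in>set xs. F (x # filter (\<lambda>y. y \<noteq> v) xs)) =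
      (\<Sum>v\<in>set xs. F (filter (\<lambda>y. y \<noteq> v) (x # xs)))"
    using Cons.prems by (intro sum.cong) auto
  ultimately show ?case using Cons.prems Cons.IH[of "\<lambda>z. F (x # z)"]
    by (simp add: o_def)
qed simp

text \<open>The sum of \<open>W\<close> over the label sequences of the monotone lattice paths. Making a path leave
  the grid downwards from the last column turns the end of a path into the value at \<open>[]\<close> and
  a single column.\<close>

fun path_sum :: "('a \<Rightarrow> 'b) list \<Rightarrow> 'a list \<Rightarrow> ('b list \<Rightarrow> 'c :: comm_monoid_add) \<Rightarrow> 'c" where
  "path_sum [] ys W = (if length ys = 1 then W [] else 0)"
| "path_sum (f # fs) [] W = 0"
| "path_sum (f # fs) (y # ys) W =
     path_sum fs (y # ys) (\<lambda>L. W (f y # L)) + path_sum (f # fs) ys (\<lambda>L. W (f y # L))"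

lemma path_sum_no_columns [simp]: "path_sum fs [] W = 0"
  by (cases fs) auto

lemma path_sum_add:
  "path_sum fs ys (\<lambda>L. W L + W' L) = path_sum fs ys W + path_sum fs ys W'"
proof (induction fs ys W arbitrary: W' rule: path_sum.induct)
  case (3 f fs y ys W)
  show ?case
    using "3.IH"[of "\<lambda>L. W' (f y # L)"] by (simp add: add_ac)
qed auto

lemma path_sum_eq_0:
  "(\<And>L. set L \<subseteq> (\<Union>f\<in>set fs. f ` set ys) \<Longrightarrow> W L = 0) \<Longrightarrow> path_sum fs ys W = 0"
proof (induction fs ys W rule: path_sum.induct)
  case (3 f fs y ys W)
  have "path_sum fs (y # ys) (\<lambda>L. W (f y # L)) = 0"
    by (rule "3.IH"(1), rule "3.prems") auto
  moreover have "path_sum (f # fs) ys (\<lambda>L. W (f y # L)) = 0"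
    by (rule "3.IH"(2), rule "3.prems") auto
  ultimately show ?case by simp
qed auto

text \<open>Modulo 2 this is the Leibniz rule for the boundary of a product of two simplices,
  triangulated by lattice paths.\<close>

lemma path_sum_deletions:
  fixes W :: "'b list \<Rightarrow> 'c :: comm_monoid_add"
  assumes add_self: "\<And>a :: 'c. a + a = 0"
  shows "sum_list (map (\<lambda>z. path_sum z ys W) (deletions fs)) +
     sum_list (map (\<lambda>z. path_sum fs z W) (deletions ys)) =
   path_sum fs ys (\<lambda>L. sum_list (map W (deletions L)))"
proof (induction fs ys W rule: path_sum.induct)
  case (1 ys W)
  have "sum_list (map (\<lambda>z. path_sum ([] :: ('a \<Rightarrow> 'b) list) z W) (deletions ys)) = 0"
  \<comment> \<open>With two columns, deleting either one leaves a single column, and the two values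
    \<open>W []\<close> cancel.\<close>
  proof (cases "length ys = 2")
    case True
    then obtain a b where "ys = [a, b]" by (auto simp: numeral_2_eq_2 length_Suc_conv)
    then show ?thesis by (simp add: add_self)
  next
    case False
    then show ?thesis by (intro sum_list_map_eq_0) (auto dest: length_deletions)
  qed
  then show ?case by simp
next
  case (2 f fs W)
  then show ?case by (simp add: o_def)
next
  case (3 f fs y ys W)
  text \<open>The term \<open>path_sum fs ys (\<lambda>L. W (f y # L))\<close>, which occurs in both induction hypotheses and so
    cancels, is the deletion of a corner.\<close>
  have cancel: "a + (a + b) = b" for a b :: 'c
    by (simp add: add_self flip: add.assoc)
  show ?case
    using "3.IH"[symmetric]
    by (simp add: path_sum_add o_def sum_list_addf add_ac cancel)
qed

section \<open>The cocycle\<close>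

text \<open>For \<open>L\<close> with entries in a finite \<open>A\<close>, this is the top
  coefficient modulo 2 of the exterior product of the entries.\<close>

definition exhausts :: "'b set \<Rightarrow> 'b list \<Rightarrow> bit" where
  "exhausts A L = of_bool (distinct L \<and> set L = A)"

text \<open>If \<open>L\<close> is distinct, every deletion misses an element of \<open>A\<close>.
  If a label repeats, only deleting one of two equal entries can leave a distinct list, and both
  choices leave the same set of labels.\<close>

lemma exhausts_deletions:
  assumes "set L \<subseteq> A"
  shows "sum_list (map (exhausts A) (deletions L)) = 0"
proof (cases "distinct L")
  case True
  have "exhausts A z = 0" if "z \<in> set (deletions L)" for z
    using deletions_distinct[OF True that] assms by (auto simp: exhausts_def)
  then show ?thesis by (auto intro: sum_list_map_eq_0)
next
  case False
  then obtain xs y ys zs where L: "L = xs @ [y] @ ys @ [y] @ zs"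
    using not_distinct_decomp by blast
  have "exhausts A (xs @ ys @ y # zs) = exhausts A (xs @ y # ys @ zs)"
    by (auto simp: exhausts_def)
  moreover have "exhausts A L' = 0" if "\<not> distinct L'" for L'
    using that by (simp add: exhausts_def)
  ultimately show ?thesis
    by (simp add: L deletions_append o_def)
qed

lemma path_sum_exhausts_eq_0:
  assumes "a \<in> A" "\<And>f y. f \<in> set fs \<Longrightarrow> y \<in> set ys \<Longrightarrow> f y \<noteq> a"
  shows "path_sum fs ys (exhausts A) = 0"
  using assms by (intro path_sum_eq_0) (fastforce simp: exhausts_def)

lemma path_sum_exhausts_cocycle:
  assumes "\<And>f y. f \<in> set fs \<Longrightarrow> y \<in> set ys \<Longrightarrow> f y \<in> A"
    and "\<And>y. y \<in> set ys \<Longrightarrow> w y \<in> A"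
    and "\<And>f i j. f \<in> set fs \<Longrightarrow> i \<in> set ys \<Longrightarrow> j \<in> set ys \<Longrightarrow> i \<noteq> j \<Longrightarrow> f i \<noteq> w j"
    and "distinct ys"
  shows "sum_list (map (\<lambda>z. path_sum z ys (exhausts A)) (deletions fs)) = 0"
proof -
  have "path_sum fs ys (\<lambda>L. sum_list (map (exhausts A) (deletions L))) = 0"
    using assms(1) by (intro path_sum_eq_0 exhausts_deletions) blast
  moreover have "path_sum fs z (exhausts A) = 0" if z: "z \<in> set (deletions ys)" for z
  proof -
    obtain j where "j \<in> set ys" "set z = set ys - {j}"
      using deletions_distinct[OF assms(4) z] by blast
    then show ?thesis using assms(2,3)
      by (intro path_sum_exhausts_eq_0[of "w j"]) auto
  qed
  then have "sum_list (map (\<lambda>z. path_sum fs z (exhausts A)) (deletions ys)) = 0"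
    by (auto intro: sum_list_map_eq_0)
  ultimately show ?thesis
    using path_sum_deletions[of ys "exhausts A" fs] by simp
qed

section \<open>Paths through constant rows\<close>

text \<open>Every path starts in the top left cell.\<close>

lemma path_sum_head_eq_0:
  "(\<And>L. W (f y # L) = 0) \<Longrightarrow> path_sum (f # fs) (y # ys) W = 0"
  by (simp add: path_sum_eq_0)

text \<open>A path must leave a constant row at once, since moving right repeats its label.\<close>

lemma path_sum_constant_row:
  assumes "\<And>L. \<not> distinct L \<Longrightarrow> W L = 0" "\<And>y. y \<in> set ys \<Longrightarrow> f y = c" "ys \<noteq> []"
  shows "path_sum (f # fs) ys W = path_sum fs ys (\<lambda>L. W (c # L))"
proof (cases ys)
  case (Cons y ys')
  have "path_sum (f # fs) ys' (\<lambda>L. W (c # L)) = 0"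
  proof (cases ys')
    case (Cons y' ys'')
    have "path_sum (f # fs) (y' # ys'') (\<lambda>L. W (c # L)) = 0"
      by (rule path_sum_head_eq_0) (simp add: assms(1,2) Cons \<open>ys = y # ys'\<close>)
    then show ?thesis by (simp only: Cons)
  qed simp
  then show ?thesis using Cons assms(2) by simp
qed (use assms in auto)

lemma path_sum_constant_rows:
  assumes "\<And>L. \<not> distinct L \<Longrightarrow> W L = 0" "ys \<noteq> []"
    and "\<And>f y. f \<in> set fs \<Longrightarrow> y \<in> set ys \<Longrightarrow> f y = k f"
  shows "path_sum (fs @ gs) ys W = path_sum gs ys (\<lambda>L. W (map k fs @ L))"
  using assms(1,3)
proof (induction fs arbitrary: W)
  case (Cons f fs)
  have "path_sum ((f # fs) @ gs) ys W = path_sum (fs @ gs) ys (\<lambda>L. W (k f # L))"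
    using Cons.prems assms(2) by (simp add: path_sum_constant_row[where c = "k f"])
  also have "\<dots> = path_sum gs ys (\<lambda>L. W (map k (f # fs) @ L))"
    using Cons.IH[of "\<lambda>L. W (k f # L)"] Cons.prems by simp
  finally show ?case .
qed simp

text \<open>A path leaving row \<open>g\<close> before the last column must move right in a constant
  row, repeating a label. Only the path along all of \<open>g\<close> and then down the last column
  survives.\<close>

lemma path_sum_one_nonconstant_row:
  assumes "\<And>L. \<not> distinct L \<Longrightarrow> W L = 0" "ys \<noteq> []"
    and "\<And>f y. f \<in> set fs \<Longrightarrow> y \<in> set ys \<Longrightarrow> f y = k f"
  shows "path_sum (g # fs) ys W = W (map g ys @ map k fs)"
  using assms
proof (induction ys arbitrary: W)
  case (Cons y ys)
  have "path_sum fs (y # ys) (\<lambda>L. W (g y # L)) =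
      path_sum [] (y # ys) (\<lambda>L. W (g y # map k fs @ L))"
    using path_sum_constant_rows[of "\<lambda>L. W (g y # L)" "y # ys" fs k "[]"] Cons.prems by simp
  moreover have "path_sum (g # fs) ys (\<lambda>L. W (g y # L)) = W (g y # map g ys @ map k fs)"
    if "ys \<noteq> []"
    using that Cons.IH[of "\<lambda>L. W (g y # L)"] Cons.prems by simp
  ultimately show ?case by (cases "ys = []") auto
qed simp

section \<open>Nontriviality of homology\<close>

text \<open>A cocycle pairs to zero with every boundary of \<open>K\<close>. The boundary of \<tau>
  is a cycle of \<open>K\<close> whose pairing with \<phi> is nonzero, so it does not bound in
  \<open>K\<close>.\<close>

lemma homology_group_Z2_nontrivial:
  fixes \<phi> :: "'a set \<Rightarrow> bit"
  assumes K: "simplicial_complex K" "finite (\<Union>K)"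
    and cocycle: "\<And>\<sigma>. \<sigma> \<in> K \<Longrightarrow> card \<sigma> = p + 2 \<Longrightarrow> (\<Sum>v\<in>\<sigma>. \<phi> (\<sigma> - {v})) = 0"
    and \<tau>: "card \<tau> = p + 2" "\<And>v. v \<in> \<tau> \<Longrightarrow> \<tau> - {v} \<in> K"
    and nonzero: "(\<Sum>v\<in>\<tau>. \<phi> (\<tau> - {v})) \<noteq> 0"
  shows "\<not> trivial_group (homology_group_Z2 p K)"
proof
  assume triv: "trivial_group (homology_group_Z2 p K)"
  let ?G = "cycle_group_Z2 p K" and ?H = "boundaries_Z2 p K"
  interpret comm_group ?G by (rule comm_group_cycle_group_Z2)
  define z where "z = boundary_Z2 (p + 1) (Poly_Mapping.single \<tau> 1)"
  have "finite \<tau>" using \<tau>(1) by (metis add_2_eq_Suc' card.infinite nat.distinct(1))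
  have z_sum: "z = (\<Sum>v\<in>\<tau>. Poly_Mapping.single (\<tau> - {v}) 1)"
    by (simp add: z_def boundary_Z2_single)
  have "boundary_Z2 p z = 0"
    unfolding z_def by (rule boundary_Z2_boundary_Z2[where K = "{\<tau>}"]) (simp add: chains_Z2_def \<tau>)
  moreover have "z \<in> chains_Z2 p K"
    unfolding z_sum using \<tau> \<open>finite \<tau>\<close> by (intro chains_Z2_sum) (auto simp: chains_Z2_def)
  ultimately have z_carrier: "z \<in> carrier ?G" by (simp add: cycle_group_Z2_def)
  have H: "subgroup ?H ?G" by (rule subgroup_boundaries_Z2[OF K(1)])
  have "?H #>\<^bsub>?G\<^esub> z \<in> carrier (?G Mod ?H)"
    using z_carrier by (auto simp: FactGroup_def RCOSETS_def)
  then have "?H #>\<^bsub>?G\<^esub> z = ?H"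
    using triv by (simp add: trivial_group_def homology_group_Z2_def FactGroup_def)
  then have "z \<in> ?H" using rcos_self[OF z_carrier H] by simp
  then obtain c where c: "c \<in> chains_Z2 (p + 1) K" "z = boundary_Z2 (p + 1) c"
    by (auto simp: boundaries_Z2_def)

  \<comment> \<open>A fixed finite index set containing all simplices of \<open>K\<close> and all
    faces of \<tau> makes the pairing with \<phi> visibly additive.\<close>
  let ?S = "Pow (\<Union>K \<union> \<tau>)"
  define \<Phi> :: "('a set \<Rightarrow>\<^sub>0 bit) \<Rightarrow> bit"
    where "\<Phi> d = (\<Sum>\<sigma>\<in>?S. Poly_Mapping.lookup d \<sigma> * \<phi> \<sigma>)" for d
  have fin: "finite ?S" using K(2) \<open>finite \<tau>\<close> by simp
  have \<Phi>_0: "\<Phi> 0 = 0" by (simp add: \<Phi>_def)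
  have \<Phi>_add: "\<Phi> (d + e) = \<Phi> d + \<Phi> e" for d e
    by (simp only: \<Phi>_def lookup_add distrib_right sum.distrib)
  note \<Phi>_sum = sum_comp_morphism[of \<Phi>, OF \<Phi>_0 \<Phi>_add, unfolded o_def, symmetric]
  have \<Phi>_single: "\<Phi> (Poly_Mapping.single \<sigma> a) = a * \<phi> \<sigma>" if "\<sigma> \<in> ?S" for \<sigma> a
  proof -
    have "\<Phi> (Poly_Mapping.single \<sigma> a) = (\<Sum>\<rho>\<in>?S. if \<sigma> = \<rho> then a * \<phi> \<sigma> else 0)"
      unfolding \<Phi>_def by (rule sum.cong) (auto simp: lookup_single when_def)
    also have "\<dots> = a * \<phi> \<sigma>" using that fin by (simp only: sum.delta' if_True)
    finally show ?thesis .
  qed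
  have "\<Phi> z = (\<Sum>v\<in>\<tau>. \<phi> (\<tau> - {v}))"
    unfolding z_sum \<Phi>_sum by (intro sum.cong refl, subst \<Phi>_single) auto
  moreover have "\<Phi> z = 0"
  proof -
    have "(\<Sum>v\<in>\<sigma>. \<Phi> (Poly_Mapping.single (\<sigma> - {v}) (Poly_Mapping.lookup c \<sigma>))) = 0"
      if "\<sigma> \<in> Poly_Mapping.keys c" for \<sigma>
    proof -
      have \<sigma>: "\<sigma> \<in> K" "card \<sigma> = p + 2" using that c(1) by (auto simp: chains_Z2_def)
      then have "(\<Sum>v\<in>\<sigma>. \<Phi> (Poly_Mapping.single (\<sigma> - {v}) (Poly_Mapping.lookup c \<sigma>))) =
          (\<Sum>v\<in>\<sigma>. Poly_Mapping.lookup c \<sigma> * \<phi> (\<sigma> - {v}))"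
        by (intro sum.cong refl, subst \<Phi>_single) auto
      then show ?thesis
        using cocycle[OF \<sigma>] by (simp only: sum_distrib_left[symmetric] mult_zero_right)
    qed
    then show ?thesis by (simp add: c(2) boundary_Z2_def \<Phi>_sum)
  qed
  ultimately show False using nonzero by simp
qed

theorem theorem4p19:
  fixes m n p :: nat
  assumes "n \<ge> 3" and "p = m - n" and "p \<ge> 1"
  shows "\<not> trivial_group
           (homology_group_Z2 p (neighbourhood_complex (const_inj_maps n m) (exp_adj n)))"
proof -
  let ?V = "const_inj_maps n m" and ?ys = "[1..<Suc n]"
  let ?K = "neighbourhood_complex ?V (exp_adj n)"
  have m: "m = n + p" using assms by simp
  have ys: "set ?ys = {1..n}" by auto
  have finV: "finite ?V"
    by (rule finite_subset[of _ "{1..n} \<rightarrow>\<^sub>E {1..m}"]) (auto simp: const_inj_maps_def intro: finite_PiE)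
  obtain vs where vs: "set vs = ?V" "distinct vs" using finite_distinct_list[OF finV] by blast
  define \<phi> where "\<phi> \<sigma> = path_sum (filter (\<lambda>v. v \<in> \<sigma>) vs) ?ys (exhausts {1..m})" for \<sigma>

  have cocycle: "(\<Sum>v\<in>\<sigma>. \<phi> (\<sigma> - {v})) = 0" if \<sigma>: "\<sigma> \<in> ?K" for \<sigma>
  proof -
    obtain w where w: "w \<in> ?V" "\<And>f. f \<in> \<sigma> \<Longrightarrow> exp_adj n f w" and "\<sigma> \<subseteq> ?V"
      using \<sigma> unfolding neighbourhood_complex_def by blast
    let ?xs = "filter (\<lambda>v. v \<in> \<sigma>) vs"
    have xs: "set ?xs = \<sigma>" "distinct ?xs" using vs \<open>\<sigma> \<subseteq> ?V\<close> by auto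
    have "filter (\<lambda>x. x \<noteq> v) ?xs = filter (\<lambda>x. x \<in> \<sigma> - {v}) vs" for v
      by (simp add: conj_commute)
    then have "(\<Sum>v\<in>\<sigma>. \<phi> (\<sigma> - {v})) =
        sum_list (map (\<lambda>z. path_sum z ?ys (exhausts {1..m})) (deletions ?xs))"
      by (simp only: sum_list_deletions_distinct[OF xs(2)] xs(1) \<phi>_def)
    also have "\<dots> = 0"
    proof (rule path_sum_exhausts_cocycle[where w = w])
      have V_values: "f y \<in> {1..m}" if "f \<in> ?V" "y \<in> set ?ys" for f y
        using that unfolding ys by (auto simp: const_inj_maps_def PiE_iff)
      show "f y \<in> {1..m}" if "f \<in> set ?xs" "y \<in> set ?ys" for f y
        using V_values that vs by auto
      show "w y \<in> {1..m}" if "y \<in> set ?ys" for y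
        using V_values that w by blast
      show "f i \<noteq> w j" if "f \<in> set ?xs" "i \<in> set ?ys" "j \<in> set ?ys" "i \<noteq> j" for f i j
        using that w(2)[of f] unfolding ys exp_adj_def by auto
    qed simp
    finally show ?thesis .
  qed

  \<comment> \<open>A cycle that pairs nontrivially with the cocycle\<close>
  define \<kappa> where "\<kappa> c = (\<lambda>i\<in>{1..n}. c)" for c :: nat
  define g where "g = (\<lambda>i\<in>{1..n}. i)"
  define C where "C = \<kappa> ` {n+1..m}"
  define \<tau> where "\<tau> = insert g (insert (\<kappa> 1) C)"
  have \<kappa>: "\<kappa> c i = c" if "i \<in> {1..n}" for c i using that by (simp add: \<kappa>_def)
  have g: "g i = i" if "i \<in> {1..n}" for i using that by (simp add: g_def)
  have \<kappa>_inj: "\<kappa> c = \<kappa> d \<longleftrightarrow> c = d" for c d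
  proof
    assume "\<kappa> c = \<kappa> d"
    then have "\<kappa> c 1 = \<kappa> d 1" by (rule arg_cong)
    then show "c = d" using assms(1) by (simp add: \<kappa>)
  qed simp
  have g_neq: "g \<noteq> \<kappa> c" for c
  proof
    assume "g = \<kappa> c"
    then have "g 1 = g 2" using assms(1) by (simp add: \<kappa>)
    then show False using assms(1) by (simp add: g)
  qed
  have \<kappa>_V: "\<kappa> c \<in> ?V" if "c \<in> {1..m}" for c
    using that by (auto simp: const_inj_maps_def \<kappa>_def)
  have g_V: "g \<in> ?V" using m by (auto simp: const_inj_maps_def g_def inj_on_def)
  have \<tau>_V: "\<tau> \<subseteq> ?V" using \<kappa>_V g_V m assms(1,3) by (auto simp: \<tau>_def C_def)
  have notin: "g \<notin> insert (\<kappa> 1) C" "\<kappa> 1 \<notin> C" using g_neq \<kappa>_inj assms(1,3) by (auto simp: C_def)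
  have "inj \<kappa>" using \<kappa>_inj by (auto simp: inj_def)
  then have card_C: "card C = p"
    by (simp add: C_def m card_image inj_on_subset)
  have finC: "finite C" by (simp add: C_def)
  have card_\<tau>: "card \<tau> = p + 2" using notin card_C finC by (simp add: \<tau>_def)

  have faces: "\<tau> - {g} = insert (\<kappa> 1) C" "\<tau> - {\<kappa> 1} = insert g C"
    using notin by (auto simp: \<tau>_def)
  have face_K: "\<tau> - {v} \<in> ?K" if v: "v \<in> \<tau>" for v
  proof -
    \<comment> \<open>Common neighbours: without \<open>g\<close>, the constant 2, which is neither
      1 nor above \<open>n\<close>; without \<open>\<kappa> 1\<close>, the looped vertex
      \<open>g\<close>; without \<open>\<kappa> c\<close>, the map \<open>\<kappa> c\<close> itself,
      whose value no other vertex of \<tau> takes.\<close>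
    have "\<exists>w\<in>?V. \<forall>a\<in>\<tau> - {v}. exp_adj n a w"
    proof -
      consider "v = g" | "v = \<kappa> 1" | c where "v = \<kappa> c" "c \<in> {n+1..m}"
        using v by (auto simp: \<tau>_def C_def)
      then show ?thesis
      proof cases
        case 1
        then show ?thesis using assms(1,3) m \<kappa>
          by (intro bexI[OF _ \<kappa>_V[of 2]]) (auto simp: faces C_def exp_adj_def)
      next
        case 2
        show ?thesis unfolding 2 faces using g \<kappa>
          by (intro bexI[OF _ g_V]) (auto simp: C_def exp_adj_def)
      next
        case 3
        then show ?thesis using g \<kappa> assms(1,3)
          by (intro bexI[OF _ \<kappa>_V[of c]]) (auto simp: \<tau>_def C_def exp_adj_def)
      qed
    qed
    moreover have "\<tau> - {v} \<noteq> {}" using card_\<tau> card_Diff_singleton[OF v] by (intro notI) simp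
    ultimately show ?thesis using \<tau>_V finC by (auto simp: neighbourhood_complex_def \<tau>_def)
  qed

  have alternating: "exhausts {1..m} L = 0" if "\<not> distinct L" for L
    using that by (simp add: exhausts_def)
  have const_rows: "f y = f 1" if "f \<in> insert (\<kappa> 1) C" "y \<in> set ?ys" for f y
    using that \<kappa> assms(1) unfolding ys by (auto simp: C_def)
  have "\<phi> (\<tau> - {g}) = 0"
  proof -
    let ?xs = "filter (\<lambda>v. v \<in> insert (\<kappa> 1) C) vs"
    have "path_sum (?xs @ []) ?ys (exhausts {1..m}) =
        path_sum [] ?ys (\<lambda>L. exhausts {1..m} (map (\<lambda>f. f 1) ?xs @ L))"
      by (rule path_sum_constant_rows[OF alternating]) (use assms(1,3) const_rows in auto)
    \<comment> \<open>Below the last row all \<open>n > 1\<close> columns remain, so no path has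
      reached the exit.\<close>
    also have "\<dots> = 0" using assms(1,3) by simp
    finally show ?thesis by (simp add: \<phi>_def faces)
  qed
  moreover have "\<phi> (\<tau> - {\<kappa> 1}) = 1"
  proof -
    \<comment> \<open>The place of \<open>g\<close> in the order is unknown: rows above it are
      descended in the first column, rows below it in the last, which gives
      \<open>?L\<close>.\<close>
    obtain us ws where split: "vs = us @ g # ws"
      using g_V vs(1) by (metis split_list)
    let ?us = "filter (\<lambda>v. v \<in> C) us" and ?ws = "filter (\<lambda>v. v \<in> C) ws"
    let ?L = "map (\<lambda>f. f 1) ?us @ map g ?ys @ map (\<lambda>f. f 1) ?ws"
    have "filter (\<lambda>v. v \<in> insert g C) vs = ?us @ g # ?ws"
    proof -
      have "filter (\<lambda>v. v \<in> insert g C) zs = filter (\<lambda>v. v \<in> C) zs" if "g \<notin> set zs" for zs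
        using that by (intro filter_cong) auto
      then show ?thesis using vs(2) unfolding split by simp
    qed
    then have "\<phi> (\<tau> - {\<kappa> 1}) = path_sum (?us @ g # ?ws) ?ys (exhausts {1..m})"
      by (simp only: \<phi>_def faces)
    also have "\<dots> = path_sum (g # ?ws) ?ys (\<lambda>L. exhausts {1..m} (map (\<lambda>f. f 1) ?us @ L))"
      by (rule path_sum_constant_rows[OF alternating]) (use assms(1,3) const_rows in auto)
    also have "\<dots> = exhausts {1..m} ?L"
      by (rule path_sum_one_nonconstant_row) (use assms(1,3) const_rows alternating in auto)
    also have "\<dots> = 1"
    proof -
      have "C \<subseteq> ?V" using \<tau>_V by (auto simp: \<tau>_def)
      then have sets: "set ?us \<union> set ?ws = C" "distinct (?us @ ?ws)"
        using vs notin unfolding split by auto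
      have C_1: "(\<lambda>f. f 1) ` C = {n+1..m}"
        using \<kappa>[of 1] assms(1) by (simp add: C_def image_image)
      have inj: "inj_on (\<lambda>f. f 1) C"
        using \<kappa>[of 1] assms(1) by (auto simp: C_def inj_on_def)
      have g_ys: "map g ?ys = ?ys" by (rule map_idI) (use g ys in auto)
      define A where "A = map (\<lambda>f. f 1) ?us"
      define B where "B = map (\<lambda>f. f 1) ?ws"
      have "distinct (map (\<lambda>f. f 1) (?us @ ?ws))"
        using sets inj by (simp add: distinct_map del: map_append filter_append)
      then have "distinct (A @ B)" by (simp only: A_def B_def map_append)
      moreover have AB: "set A \<union> set B = {n+1..m}"
        using C_1 sets(1) by (simp only: A_def B_def set_map flip: image_Un)
      then have "(set A \<union> set B) \<inter> {1..n} = {}" unfolding AB by auto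
      ultimately have "distinct (A @ ?ys @ B)"
        using distinct_upt[of 1 "Suc n"] unfolding distinct_append set_append ys by blast
      moreover have "set (A @ ?ys @ B) = {n+1..m} \<union> {1..n}"
        using AB unfolding set_append ys by blast
      moreover have "{n+1..m} \<union> {1..n} = {1..m}" using m by auto
      ultimately show ?thesis
        unfolding g_ys exhausts_def A_def[symmetric] B_def[symmetric] of_bool_eq_1_iff by metis
    qed
    finally show ?thesis .
  qed
  moreover have "\<phi> (\<tau> - {v}) = 0" if v: "v \<in> C" for v
  proof -
    obtain c where c: "v = \<kappa> c" "c \<in> {n+1..m}" using v by (auto simp: C_def)
    have "f y \<noteq> c" if "f \<in> \<tau> - {v}" "y \<in> set ?ys" for f y
      using that c g \<kappa> assms(1,3) unfolding ys by (auto simp: \<tau>_def C_def)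
    then show ?thesis unfolding \<phi>_def
      using c by (intro path_sum_exhausts_eq_0[of c]) auto
  qed
  ultimately have "(\<Sum>v\<in>\<tau>. \<phi> (\<tau> - {v})) = 1"
    unfolding \<tau>_def using notin finC by simp
  moreover have "finite (\<Union>?K)"
    by (rule finite_subset[OF _ finV]) (auto simp: neighbourhood_complex_def)
  ultimately show ?thesis
    using cocycle card_\<tau> face_K
    by (intro homology_group_Z2_nontrivial[where \<phi> = \<phi> and \<tau> = \<tau>]
        simplicial_complex_neighbourhood_complex) auto
qed

end
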